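(* Let $d\ge2$ be even. Then $\widetilde{P}_{\partial(\sigma_{d+1})}$ is of combinatorial type $T^d_{d/2}$. In particular, $\widetilde{P}_{\partial(\sigma_{d+1})}$ is combinatorially equivalent to a $d$-dimensional cyclic polytope on $d+2$ vertices.
   Context: Let $\sigma_{d+1}=2^{[d+2]}$ be the full simplex on vertex set $[d+2]=\{1<2<\dots<d+2\}$ and $\Delta=\partial(\sigma_{d+1})=\sigma_{d+1}\setminus\{[d+2]\}$ its boundary, a $d$-dimensional simplicial complex. The simplicial boundary map $\partial_d$ is $\partial_d(e_\sigma)=\sum_{k=1}^{d+1}(-1)^{k-1}e_{\sigma\setminus\{j_k\}}$ for a $d$-face $\sigma=\{j_1<\dots<j_{d+1}\}$, and the $d$-th Laplacian matrix is $\mathcal{L}_d(\Delta)=\partial_d^{\top}\partial_d\in\mathbb{Z}^{(d+2)\times(d+2)}$ (as $\partial_{d+1}=0$), with rows and columns ordered according to the facets $F_1,\dots,F_{d+2}$, $F_i=[d+2]\setminus\{d+3-i\}$. For $d$ even, $\widetilde{P}_{\partial(\sigma_{d+1})}\subseteq\mathbb{R}^d$ is the convex hull of the columns of the $d\times(d+2)$-matrix obtained from $\mathcal{L}_d(\Delta)$ by deleting its first two rows. For $1\le k\le d-1$, $T^d_k$ denotes the combinatorial type of the simplicial $d$-polytope obtained as the convex hull of a $d$-simplex $T^d$ and a point $v$ that is beyond exactly $k$ facets of $T^d$ (on the side of the facet hyperplane not containing $T^d$) and beneath all other facets (strictly on the same side as $T^d$); this type depends only on $k$ and $d$. Two polytopes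 are combinatorially equivalent if their face lattices are isomorphic. A $d$-dimensional cyclic polytope on $n$ vertices is the convex hull of $n$ distinct points on the moment curve $t\mapsto(t,t^2,\dots,t^d)$. *)

theory Defs
  imports "HOL-Analysis.Analysis"
begin

text \<open>
  Vectors of \<open>\<real>\<^sup>d\<close> are elements of \<open>real ^ 'n\<close> with \<open>d = CARD('n)\<close>. The index type is linearly
  ordered, so that its elements can be numbered \<open>1, \<dots>, d\<close> and "the \<open>i\<close>-th coordinate" makes sense.
\<close>

definition coord_no :: "'n::{finite,linorder} \<Rightarrow> nat" where
  "coord_no a = card {b. b \<le> a}"


definition full_simplex :: "nat \<Rightarrow> nat set set" where
  "full_simplex d = Pow {1..d + 1}"

definition boundary_complex :: "nat \<Rightarrow> nat set set" where
  "boundary_complex d = full_simplex (d + 1) - {{1..d + 2}}"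

definition k_faces :: "nat set set \<Rightarrow> nat \<Rightarrow> nat set set" where
  "k_faces \<Delta> k = {\<sigma> \<in> \<Delta>. card \<sigma> = k + 1}"

text \<open>
  The coefficient of \<open>e\<^sub>\<tau>\<close> in \<open>\<partial>(e\<^sub>\<sigma>)\<close>. For \<open>\<sigma> = {j\<^sub>1 < j\<^sub>2 < \<dots>}\<close>, the element \<open>j = j\<^sub>k\<close> has exactly
  \<open>k - 1\<close> smaller elements in \<open>\<sigma>\<close>, whence the sign \<open>(-1) ^ (k - 1)\<close>.
\<close>

definition boundary_coeff :: "nat set \<Rightarrow> nat set \<Rightarrow> int" where
  "boundary_coeff \<tau> \<sigma> =
     (\<Sum>j\<in>\<sigma>. if \<tau> = \<sigma> - {j} then (-1) ^ card {i \<in> \<sigma>. i < j} else 0)"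

text \<open>
  The entries of \<open>\<partial>\<^sub>k\<^sup>T \<partial>\<^sub>k\<close>, indexed by \<open>k\<close>-faces (\<open>k \<ge> 1\<close>). For \<open>k = dim \<Delta>\<close> this is the \<open>k\<close>-th Laplacian,
  because then \<open>\<partial>\<^sub>k\<^sub>+\<^sub>1 = 0\<close>.
\<close>

definition laplacian :: "nat set set \<Rightarrow> nat \<Rightarrow> nat set \<Rightarrow> nat set \<Rightarrow> int" where
  "laplacian \<Delta> k \<sigma> \<sigma>' =
     (\<Sum>\<tau> \<in> k_faces \<Delta> (k - 1). boundary_coeff \<tau> \<sigma> * boundary_coeff \<tau> \<sigma>')"

definition facet_no :: "nat \<Rightarrow> nat \<Rightarrow> nat set" where
  "facet_no d i = {1..d + 2} - {d + 3 - i}"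

text \<open>Rows and columns are numbered from \<open>1\<close> to \<open>d + 2\<close>.\<close>

definition laplacian_matrix :: "nat \<Rightarrow> nat \<Rightarrow> nat \<Rightarrow> int" where
  "laplacian_matrix d i j = laplacian (boundary_complex d) d (facet_no d i) (facet_no d j)"

text \<open>
  Deleting the first two rows makes row \<open>i + 2\<close> of the Laplacian matrix the \<open>i\<close>-th row.
\<close>

definition reduced_column :: "nat \<Rightarrow> real ^ 'n::{finite,linorder}" where
  "reduced_column j = (\<chi> a. of_int (laplacian_matrix CARD('n) (coord_no a + 2) j))"

definition laplacian_polytope :: "(real ^ 'n::{finite,linorder}) set" where
  "laplacian_polytope = convex hull (reduced_column ` {1..CARD('n) + 2})"


definition comb_equiv :: "'a::real_vector set \<Rightarrow> 'b::real_vector set \<Rightarrow> bool" where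
  "comb_equiv P Q \<longleftrightarrow>
     (\<exists>f. bij_betw f {F. F face_of P} {G. G face_of Q} \<and>
          (\<forall>F F'. F face_of P \<longrightarrow> F' face_of P \<longrightarrow> (F \<subseteq> F' \<longleftrightarrow> f F \<subseteq> f F')))"

text \<open>
  For a facet \<open>F\<close> of a full-dimensional polytope \<open>P\<close>; only then is \<open>affine hull F\<close> a hyperplane.
\<close>

definition beyond :: "'a::euclidean_space \<Rightarrow> 'a set \<Rightarrow> 'a set \<Rightarrow> bool" where
  "beyond v P F \<longleftrightarrow>
     (\<exists>a b. a \<noteq> 0 \<and> affine hull F = {x. a \<bullet> x = b} \<and> P \<subseteq> {x. a \<bullet> x \<le> b} \<and> a \<bullet> v > b)"

definition beneath :: "'a::euclidean_space \<Rightarrow> 'a set \<Rightarrow> 'a set \<Rightarrow> bool" where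
  "beneath v P F \<longleftrightarrow>
     (\<exists>a b. a \<noteq> 0 \<and> affine hull F = {x. a \<bullet> x = b} \<and> P \<subseteq> {x. a \<bullet> x \<le> b} \<and> a \<bullet> v < b)"

text \<open>The polytopes representing \<open>T\<^sup>d\<^sub>k\<close>, where \<open>d\<close> is the dimension of the ambient space.\<close>

definition T_polytope :: "nat \<Rightarrow> 'a::euclidean_space set \<Rightarrow> bool" where
  "T_polytope k Q \<longleftrightarrow> 1 \<le> k \<and> k \<le> DIM('a) - 1 \<and>
     (\<exists>T v. int DIM('a) simplex T \<and>
            card {F. F facet_of T \<and> beyond v T F} = k \<and>
            (\<forall>F. F facet_of T \<and> \<not> beyond v T F \<longrightarrow> beneath v T F) \<and>
            Q = convex hull (insert v T))"

definition of_type_T :: "nat \<Rightarrow> 'a::euclidean_space set \<Rightarrow> bool" where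
  "of_type_T k P \<longleftrightarrow> (\<exists>Q :: 'a set. T_polytope k Q \<and> comb_equiv P Q)"

definition moment_curve :: "real \<Rightarrow> real ^ 'n::{finite,linorder}" where
  "moment_curve t = (\<chi> a. t ^ coord_no a)"

definition cyclic_polytope :: "nat \<Rightarrow> (real ^ 'n::{finite,linorder}) set \<Rightarrow> bool" where
  "cyclic_polytope n C \<longleftrightarrow>
     (\<exists>A. finite A \<and> card A = n \<and> C = convex hull (moment_curve ` A))"

end

theory Submission
  imports Defs "HOL-Computational_Algebra.Polynomial"
begin

text \<open>
  The Laplacian is \<open>(d + 2) I - c c\<^sup>T\<close> with \<open>c\<close> the alternating sign vector, so the \<open>d + 2\<close> columns of
  the reduced matrix have \<open>c\<close> as their only affine dependency up to scaling. The sign pattern of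
  that dependency determines the combinatorics: a set of points spans a face iff it is the zero set
  of a nonnegative vector orthogonal to the dependency, and the point \<open>i\<close> is beyond the facet of the
  simplex on the other points that omits \<open>u\<close> iff \<open>i\<close> and \<open>u\<close> have the same sign. Points on the moment
  curve with parameters \<open>1, \<dots>, d + 2\<close> have the dependency \<open>(-1) ^ j * (d + 1 choose j)\<close>, which
  alternates as well.
\<close>

section \<open>Faces of a convex hull of finitely many points\<close>

text \<open>Index sets instead of point sets, so that configurations in different spaces can be
  compared. The normal \<open>a\<close> may be 0, which covers the improper faces \<open>J\<close>
  and \<open>{}\<close>.\<close>

definition supporting_sets :: "'i set \<Rightarrow> ('i \<Rightarrow> 'a::euclidean_space) \<Rightarrow> 'i set set" where
  "supporting_sets J p =
     {S. S \<subseteq> J \<and> (\<exists>a b. (\<forall>j\<in>S. a \<bullet> p j = b) \<and> (\<forall>j\<in>J - S. a \<bullet> p j < b))}"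

text \<open>A face is the hull of some generators, and only those with index in \<open>S\<close> lie
  on the hyperplane. The third claim recovers \<open>S\<close> from its face although
  \<open>p\<close> need not be injective.\<close>

lemma convex_hull_image_eq_Int_hyperplane:
  fixes p :: "'i \<Rightarrow> 'a::euclidean_space"
  assumes "finite J" "S \<subseteq> J" and S: "\<And>j. j \<in> S \<Longrightarrow> a \<bullet> p j = b"
    and nS: "\<And>j. j \<in> J - S \<Longrightarrow> a \<bullet> p j < b"
  shows "convex hull (p ` S) = convex hull (p ` J) \<inter> {x. a \<bullet> x = b}"
    and "convex hull (p ` S) face_of convex hull (p ` J)"
    and "{j \<in> J. p j \<in> convex hull (p ` S)} = S"
proof -
  let ?H = "{x. a \<bullet> x = b}"
  have le: "convex hull (p ` J) \<subseteq> {x. a \<bullet> x \<le> b}"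
    by (rule hull_minimal) (use S nS in \<open>auto simp: convex_halfspace_le less_imp_le, metis DiffI S order.refl less_imp_le\<close>)
  have face: "convex hull (p ` J) \<inter> ?H face_of convex hull (p ` J)"
    using le by (intro face_of_Int_supporting_hyperplane_le) auto
  have comp: "compact (p ` J)"
    using \<open>finite J\<close> by (simp add: finite_imp_compact)
  obtain X where X: "X \<subseteq> p ` J" "convex hull (p ` J) \<inter> ?H = convex hull X"
    using face_of_convex_hull_subset[OF comp face] by metis
  have "X \<subseteq> p ` S"
  proof
    fix x assume "x \<in> X"
    then obtain j where j: "j \<in> J" "x = p j" using X(1) by auto
    have "a \<bullet> x = b" using X(2) \<open>x \<in> X\<close> hull_subset[of X convex] by auto
    then show "x \<in> p ` S" using nS[of j] j by force
  qed
  then have "convex hull X \<subseteq> convex hull (p ` S)" by (rule hull_mono)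
  moreover have H: "convex hull (p ` S) \<subseteq> ?H"
    by (rule hull_minimal) (use S in \<open>auto simp: convex_hyperplane\<close>)
  moreover have "convex hull (p ` S) \<subseteq> convex hull (p ` J)"
    using \<open>S \<subseteq> J\<close> by (intro hull_mono image_mono)
  ultimately show eq: "convex hull (p ` S) = convex hull (p ` J) \<inter> ?H"
    using X(2) by blast
  show "convex hull (p ` S) face_of convex hull (p ` J)"
    using face eq by simp
  have "j \<in> S" if "j \<in> J" "p j \<in> convex hull (p ` S)" for j
    using that H nS[of j] by force
  moreover have "p j \<in> convex hull (p ` S)" if "j \<in> S" for j
    using that by (simp add: hull_inc)
  ultimately show "{j \<in> J. p j \<in> convex hull (p ` S)} = S"
    using \<open>S \<subseteq> J\<close> by blast
qed

text \<open>Faces of a polytope are exposed; take the indices of the points on an exposing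
  hyperplane.\<close>

lemma face_of_convex_hull_supporting_set:
  fixes p :: "'i \<Rightarrow> 'a::euclidean_space"
  assumes "finite J" and F: "F face_of convex hull (p ` J)"
  shows "\<exists>S\<in>supporting_sets J p. F = convex hull (p ` S)"
proof -
  have "polyhedron (convex hull (p ` J))"
    using \<open>finite J\<close> by (simp add: polyhedron_convex_hull)
  then have "F exposed_face_of convex hull (p ` J)"
    using F exposed_face_of_polyhedron by blast
  then obtain a b where ab: "convex hull (p ` J) \<subseteq> {x. a \<bullet> x \<le> b}"
    "F = convex hull (p ` J) \<inter> {x. a \<bullet> x = b}"
    unfolding exposed_face_of_def by blast
  define S where "S = {j \<in> J. a \<bullet> p j = b}"
  have "a \<bullet> p j \<le> b" if "j \<in> J" for j
    using ab(1) that by (auto intro: hull_inc)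
  then have lt: "a \<bullet> p j < b" if "j \<in> J - S" for j
    using that by (force simp: S_def)
  have "S \<in> supporting_sets J p"
    using lt unfolding supporting_sets_def by (auto simp: S_def intro!: exI[of _ a] exI[of _ b])
  moreover have "convex hull (p ` S) = F"
    unfolding ab(2)
    by (rule convex_hull_image_eq_Int_hyperplane[OF \<open>finite J\<close> _ _ lt]) (auto simp: S_def)
  ultimately show ?thesis by blast
qed

text \<open>Both face lattices are isomorphic to the supporting sets ordered by inclusion: a face is
  sent to the indices of the points it contains, and these to their hull on the other side.\<close>

lemma comb_equiv_if_same_supporting_sets:
  fixes p :: "'i \<Rightarrow> 'a::euclidean_space" and q :: "'i \<Rightarrow> 'b::euclidean_space"
  assumes "finite J" and eq: "supporting_sets J p = supporting_sets J q"
  shows "comb_equiv (convex hull (p ` J)) (convex hull (q ` J))"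
proof -
  define V where "V F = {j \<in> J. p j \<in> F}" for F
  define W where "W F = {j \<in> J. q j \<in> F}" for F
  define f where "f F = convex hull (q ` V F)" for F
  define g where "g F = convex hull (p ` W F)" for F
  have p: "convex hull (p ` S) face_of convex hull (p ` J)" "V (convex hull (p ` S)) = S"
    if "S \<in> supporting_sets J p" for S
    using that convex_hull_image_eq_Int_hyperplane(2,3)[OF \<open>finite J\<close>, of S _ p]
    unfolding supporting_sets_def V_def by blast+
  have q: "convex hull (q ` S) face_of convex hull (q ` J)" "W (convex hull (q ` S)) = S"
    if "S \<in> supporting_sets J p" for S
    using that convex_hull_image_eq_Int_hyperplane(2,3)[OF \<open>finite J\<close>, of S _ q]
    unfolding eq unfolding supporting_sets_def W_def by blast+
  have P: "\<exists>S\<in>supporting_sets J p. F = convex hull (p ` S)" if "F face_of convex hull (p ` J)" for F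
    using face_of_convex_hull_supporting_set[OF \<open>finite J\<close> that] .
  have Q: "\<exists>S\<in>supporting_sets J p. F = convex hull (q ` S)" if "F face_of convex hull (q ` J)" for F
    using face_of_convex_hull_supporting_set[OF \<open>finite J\<close> that] eq by simp
  have "bij_betw f {F. F face_of convex hull (p ` J)} {G. G face_of convex hull (q ` J)}"
  proof (rule bij_betw_byWitness[where f' = g])
    show "\<forall>F\<in>{F. F face_of convex hull (p ` J)}. g (f F) = F"
      using P p q by (fastforce simp: f_def g_def)
    show "\<forall>G\<in>{G. G face_of convex hull (q ` J)}. f (g G) = G"
      using Q p q by (fastforce simp: f_def g_def)
    show "f ` {F. F face_of convex hull (p ` J)} \<subseteq> {G. G face_of convex hull (q ` J)}"
      using P p q by (fastforce simp: f_def)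
    show "g ` {G. G face_of convex hull (q ` J)} \<subseteq> {F. F face_of convex hull (p ` J)}"
      using Q p q by (fastforce simp: g_def)
  qed
  moreover have "F \<subseteq> F' \<longleftrightarrow> f F \<subseteq> f F'"
    if "F face_of convex hull (p ` J)" "F' face_of convex hull (p ` J)" for F F'
  proof -
    obtain S S' where S: "S \<in> supporting_sets J p" "F = convex hull (p ` S)"
      and S': "S' \<in> supporting_sets J p" "F' = convex hull (p ` S')"
      using P \<open>F face_of _\<close> \<open>F' face_of _\<close> by blast
    have V: "V F = S" "V F' = S'" using p(2) S S' by simp_all
    have "F \<subseteq> F' \<longleftrightarrow> S \<subseteq> S'"
    proof
      assume "F \<subseteq> F'"
      then have "V F \<subseteq> V F'" unfolding V_def by blast
      then show "S \<subseteq> S'" using V by simp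
    qed (use S S' in \<open>simp add: hull_mono image_mono\<close>)
    moreover have "f F \<subseteq> f F' \<longleftrightarrow> S \<subseteq> S'"
    proof
      assume "f F \<subseteq> f F'"
      then have "W (f F) \<subseteq> W (f F')" unfolding W_def by blast
      then show "S \<subseteq> S'" using V S S' q(2) by (simp add: f_def)
    qed (use V in \<open>simp add: f_def hull_mono image_mono\<close>)
    ultimately show ?thesis by simp
  qed
  ultimately show ?thesis unfolding comb_equiv_def by blast
qed

lemma comb_equiv_refl: "comb_equiv P P"
  unfolding comb_equiv_def by (rule exI[of _ id]) auto

section \<open>Configurations with a unique affine dependency\<close>

text \<open>With one point moved to the origin the others become linearly independent, so a linear
  functional takes any values on them; the offset \<open>b\<close> adjusts the value at the chosen
  point.\<close>

lemma affine_independent_interpolation: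
  fixes S :: "'a::euclidean_space set" and z :: "'a \<Rightarrow> real"
  assumes "\<not> affine_dependent S"
  obtains a b where "\<And>x. x \<in> S \<Longrightarrow> a \<bullet> x - b = z x"
proof (cases "S = {}")
  case False
  then obtain x0 where x0: "x0 \<in> S" by blast
  let ?B = "(\<lambda>x. - x0 + x) ` (S - {x0})"
  have "independent ?B"
    using affine_dependent_iff_dependent2[OF x0] assms by simp
  then obtain g where g: "linear g" "\<And>y. y \<in> ?B \<Longrightarrow> g y = z (x0 + y) - z x0"
    using linear_independent_extend[of ?B "\<lambda>y. z (x0 + y) - z x0"] by blast
  have a: "adjoint g 1 \<bullet> y = g y" for y
    using adjoint_works[OF g(1), of y 1] by (simp add: inner_commute)
  have "adjoint g 1 \<bullet> x - (adjoint g 1 \<bullet> x0 - z x0) = z x" if "x \<in> S" for x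
  proof (cases "x = x0")
    case False
    then have "g (- x0 + x) = z x - z x0"
      using g(2)[of "- x0 + x"] that by auto
    then show ?thesis
      using g(1) by (simp add: a linear_diff)
  qed simp
  then show ?thesis using that by blast
qed (use that in blast)

text \<open>In matroid terms a circuit of full size: the dependency space is the line through
  \<open>c\<close>, and as no entry of \<open>c\<close> vanishes, dropping any point leaves an
  affinely independent set.\<close>

locale affine_circuit =
  fixes J :: "'i set" and p :: "'i \<Rightarrow> 'a::euclidean_space" and c :: "'i \<Rightarrow> real"
  assumes finite_J: "finite J"
    and card_J: "card J = DIM('a) + 2"
    and sum_c: "sum c J = 0"
    and sum_c_p: "(\<Sum>j\<in>J. c j *\<^sub>R p j) = 0"
    and c_nonzero: "j \<in> J \<Longrightarrow> c j \<noteq> 0"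
    and dependency_unique:
      "\<lbrakk>sum u J = 0; (\<Sum>j\<in>J. u j *\<^sub>R p j) = 0\<rbrakk> \<Longrightarrow> \<exists>k. \<forall>j\<in>J. u j = k * c j"
begin

lemma dependency_eq_zero:
  assumes "sum u J = 0" "(\<Sum>j\<in>J. u j *\<^sub>R p j) = 0" "i \<in> J" "u i = 0" "j \<in> J"
  shows "u j = 0"
proof -
  obtain k where k: "\<And>j. j \<in> J \<Longrightarrow> u j = k * c j"
    using dependency_unique[OF assms(1,2)] by blast
  with assms(3,4) c_nonzero have "k = 0" by force
  then show ?thesis using k assms(5) by simp
qed

lemma sum_dependency: "(\<Sum>j\<in>J. c j * (a \<bullet> p j - b)) = 0"
proof -
  have "(\<Sum>j\<in>J. c j * (a \<bullet> p j - b)) = a \<bullet> (\<Sum>j\<in>J. c j *\<^sub>R p j) - sum c J * b"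
    by (simp add: inner_sum_right right_diff_distrib sum_subtractf sum_distrib_right)
  then show ?thesis by (simp add: sum_c sum_c_p)
qed

lemma inj_on_remove:
  assumes "i \<in> J"
  shows "inj_on p (J - {i})"
proof (rule inj_onI, rule ccontr)
  fix x y assume xy: "x \<in> J - {i}" "y \<in> J - {i}" "p x = p y" "x \<noteq> y"
  \<comment> \<open>Coinciding points would give this dependency, which is 0 at \<open>i\<close> but
    not at \<open>x\<close>.\<close>
  define u :: "'i \<Rightarrow> real" where "u j = (if j = x then 1 else 0) - (if j = y then 1 else 0)" for j
  have "sum u J = 0"
    using xy finite_J by (simp add: u_def sum_subtractf)
  moreover have "(\<Sum>j\<in>J. u j *\<^sub>R p j) = 0"
    using xy finite_J
    by (simp add: u_def scaleR_diff_left sum_subtractf if_distrib[of "\<lambda>r. r *\<^sub>R _"] cong: if_cong)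
  ultimately have "u x = 0"
    using dependency_eq_zero[of u i x] xy assms by (auto simp: u_def)
  then show False using xy by (simp add: u_def)
qed

lemma affine_independent_remove:
  assumes "i \<in> J"
  shows "\<not> affine_dependent (p ` (J - {i}))"
proof
  assume "affine_dependent (p ` (J - {i}))"
  then obtain U j where U: "sum U (p ` (J - {i})) = 0" "j \<in> J - {i}" "U (p j) \<noteq> 0"
    "(\<Sum>v\<in>p ` (J - {i}). U v *\<^sub>R v) = 0"
    using finite_J by (subst (asm) affine_dependent_explicit_finite) auto
  \<comment> \<open>Extension by 0 at \<open>i\<close> gives a dependency of the whole
    configuration.\<close>
  define u where "u j = (if j = i then 0 else U (p j))" for j
  have "sum u J = sum u (J - {i})"
    using finite_J assms by (simp add: sum.remove u_def)
  also have "\<dots> = 0"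
    using U(1) by (simp add: sum.reindex[OF inj_on_remove[OF assms]] u_def)
  finally have 1: "sum u J = 0" .
  have "(\<Sum>j\<in>J. u j *\<^sub>R p j) = (\<Sum>j\<in>J - {i}. u j *\<^sub>R p j)"
    using finite_J assms by (simp add: sum.remove u_def)
  also have "\<dots> = 0"
    using U(4) by (simp add: sum.reindex[OF inj_on_remove[OF assms]] u_def)
  finally have "u j = 0"
    using dependency_eq_zero[OF 1 _ assms, of j] U(2) by (simp add: u_def)
  then show False using U(2,3) by (simp add: u_def)
qed

lemma interpolation:
  assumes "i \<in> J"
  obtains a b where "\<And>j. j \<in> J - {i} \<Longrightarrow> a \<bullet> p j - b = z j"
proof -
  obtain a b where "\<And>x. x \<in> p ` (J - {i}) \<Longrightarrow> a \<bullet> x - b = z (the_inv_into (J - {i}) p x)"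
    using affine_independent_interpolation[OF affine_independent_remove[OF assms],
        where z = "\<lambda>x. z (the_inv_into (J - {i}) p x)"] by blast
  then show ?thesis
    using that[of a b] the_inv_into_f_f[OF inj_on_remove[OF assms]] by simp
qed

text \<open>Interpolating at all indices but one suffices: both value vectors are orthogonal to
  \<open>c\<close>, so the last value is forced because \<open>c i\<close> is nonzero.\<close>

lemma interpolation_orthogonal:
  assumes "(\<Sum>j\<in>J. c j * z j) = 0"
  obtains a b where "\<And>j. j \<in> J \<Longrightarrow> a \<bullet> p j - b = z j"
proof -
  obtain i where i: "i \<in> J" using card_J by fastforce
  obtain a b where ab: "\<And>j. j \<in> J - {i} \<Longrightarrow> a \<bullet> p j - b = z j"
    using interpolation[OF i] by metis
  have "c i * (a \<bullet> p i - b) + (\<Sum>j\<in>J - {i}. c j * (a \<bullet> p j - b)) = 0"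
    using sum_dependency[of a b] finite_J i by (simp add: sum.remove)
  moreover have "c i * z i + (\<Sum>j\<in>J - {i}. c j * z j) = 0"
    using assms finite_J i by (simp add: sum.remove)
  moreover have "(\<Sum>j\<in>J - {i}. c j * (a \<bullet> p j - b)) = (\<Sum>j\<in>J - {i}. c j * z j)"
    using ab by simp
  ultimately have "c i * (a \<bullet> p i - b) = c i * z i" by linarith
  then have "a \<bullet> p i - b = z i" using c_nonzero[OF i] by simp
  then show ?thesis using that[of a b] ab by blast
qed

text \<open>In \<open>sum_dependency\<close> only the terms of \<open>u\<close> and \<open>i\<close>
  survive. This ties the side of \<open>p i\<close> to the side of \<open>p u\<close>.\<close>

lemma dependency_two:
  assumes "i \<in> J" "u \<in> J - {i}" and "\<And>j. j \<in> J - {i} - {u} \<Longrightarrow> a \<bullet> p j = b"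
  shows "c u * (a \<bullet> p u - b) + c i * (a \<bullet> p i - b) = 0"
proof -
  have "(\<Sum>j\<in>J. c j * (a \<bullet> p j - b)) =
      c i * (a \<bullet> p i - b) + (c u * (a \<bullet> p u - b) + (\<Sum>j\<in>J - {i} - {u}. c j * (a \<bullet> p j - b)))"
    using assms finite_J by (simp add: sum.remove)
  also have "(\<Sum>j\<in>J - {i} - {u}. c j * (a \<bullet> p j - b)) = 0"
    using assms(3) by simp
  finally show ?thesis using sum_dependency[of a b] by simp
qed

text \<open>The affine function that is -1 at \<open>p u\<close> and 0 at the other simplex vertices
  cuts out the facet opposite \<open>p u\<close>; \<open>dependency_two\<close> gives its value at
  \<open>p i\<close>.\<close>

lemma facet_hyperplane:
  assumes i: "i \<in> J" and u: "u \<in> J - {i}"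
  obtains a b where "a \<noteq> 0" "affine hull (p ` (J - {i} - {u})) = {x. a \<bullet> x = b}"
    "convex hull (p ` (J - {i})) \<subseteq> {x. a \<bullet> x \<le> b}" "a \<bullet> p i - b = c u / c i"
proof -
  let ?K = "J - {i} - {u}"
  obtain a b where ab: "\<And>j. j \<in> J - {i} \<Longrightarrow> a \<bullet> p j - b = (if j = u then -1 else 0)"
    using interpolation[OF i, of "\<lambda>j. if j = u then -1 else 0"] by metis
  have K: "a \<bullet> p j = b" if "j \<in> ?K" for j using ab[of j] that by auto
  have pu: "a \<bullet> p u - b = -1" using ab[OF u] by simp
  have cardK: "card ?K = DIM('a)"
    using card_J finite_J i u by simp
  have "?K \<noteq> {}" using cardK DIM_positive[where 'a='a] by (metis card.empty less_irrefl)
  then obtain j where j: "j \<in> ?K" by blast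
  have a: "a \<noteq> 0"
  proof
    assume "a = 0"
    then show False using K[OF j] pu by simp
  qed
  have indep: "\<not> affine_dependent (p ` ?K)"
    using affine_independent_remove[OF i] by (rule contrapos_nn) (auto intro: affine_dependent_subset)
  have "card (p ` ?K) = DIM('a)"
    using cardK inj_on_remove[OF i] by (subst card_image) (auto intro: inj_on_subset)
  then have dim: "aff_dim (p ` ?K) = int DIM('a) - 1"
    using aff_dim_affine_independent[OF indep] by simp
  \<comment> \<open>Both sides have dimension \<open>DIM('a) - 1\<close>, so inclusion gives
    equality.\<close>
  have "affine hull (p ` ?K) = {x. a \<bullet> x = b}"
  proof (rule affine_dim_equal)
    show "affine hull (p ` ?K) \<noteq> {}" using j by auto
    show "affine hull (p ` ?K) \<subseteq> {x. a \<bullet> x = b}"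
      by (rule hull_minimal) (use K in \<open>auto simp: affine_hyperplane\<close>)
    show "aff_dim (affine hull (p ` ?K)) = aff_dim {x. a \<bullet> x = b}"
      using dim a by (simp add: aff_dim_hyperplane)
  qed (auto simp: affine_hyperplane)
  moreover have "convex hull (p ` (J - {i})) \<subseteq> {x. a \<bullet> x \<le> b}"
  proof (rule hull_minimal)
    show "p ` (J - {i}) \<subseteq> {x. a \<bullet> x \<le> b}"
      using K pu by (smt (verit) DiffI image_subsetI mem_Collect_eq singletonD)
  qed (simp add: convex_halfspace_le)
  moreover have "a \<bullet> p i - b = c u / c i"
    using dependency_two[OF i u, of a b] K pu c_nonzero[OF i] by (simp add: field_simps)
  ultimately show ?thesis using that a by blast
qed

lemma beyond_facet_iff:
  assumes i: "i \<in> J" and u: "u \<in> J - {i}"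
  shows "beyond (p i) (convex hull (p ` (J - {i}))) (convex hull (p ` (J - {i} - {u})))
    \<longleftrightarrow> 0 < c u * c i" (is "?L \<longleftrightarrow> ?R")
proof
  assume ?R
  then have "0 < c u / c i" by (simp add: zero_less_mult_iff zero_less_divide_iff)
  then show ?L
    using facet_hyperplane[OF i u] unfolding beyond_def affine_hull_convex_hull
    by (smt (verit, best))
next
  assume ?L
  then obtain a b where ab: "affine hull (p ` (J - {i} - {u})) = {x. a \<bullet> x = b}"
    "convex hull (p ` (J - {i})) \<subseteq> {x. a \<bullet> x \<le> b}" "a \<bullet> p i > b"
    unfolding beyond_def affine_hull_convex_hull by blast
  have K: "a \<bullet> p j = b" if "j \<in> J - {i} - {u}" for j
    using ab(1) hull_inc[of "p j" "p ` (J - {i} - {u})" affine] that by blast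
  have pu: "a \<bullet> p u \<le> b"
    using ab(2) hull_inc[of "p u" "p ` (J - {i})" convex] u by blast
  have eq: "c u * (b - a \<bullet> p u) = c i * (a \<bullet> p i - b)"
    using dependency_two[OF i u K] by (simp add: algebra_simps)
  \<comment> \<open>Multiplying by \<open>c i\<close> makes the right side positive; as
    \<open>b - a \<bullet> p u\<close> is nonnegative, \<open>c i * c u\<close> must be
    positive.\<close>
  then have "c i * c u * (b - a \<bullet> p u) = c i * c i * (a \<bullet> p i - b)"
    by (metis mult.assoc)
  moreover have "0 < c i * c i * (a \<bullet> p i - b)"
    using ab(3) c_nonzero[OF i] by (simp add: zero_less_mult_iff not_less_iff_gr_or_eq) linarith
  ultimately show ?R
    using pu by (metis diff_ge_0_iff_ge mult.commute zero_less_mult_pos2 less_le mult_zero_right)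
qed

lemma beneath_facet:
  assumes i: "i \<in> J" and u: "u \<in> J - {i}" and "c u * c i < 0"
  shows "beneath (p i) (convex hull (p ` (J - {i}))) (convex hull (p ` (J - {i} - {u})))"
proof -
  have "c u / c i < 0" using assms(3) by (simp add: mult_less_0_iff divide_less_0_iff)
  then show ?thesis
    using facet_hyperplane[OF i u] unfolding beneath_def affine_hull_convex_hull
    by (smt (verit, best))
qed

section \<open>Facets of the simplex on all points but one, and the type of the whole
  polytope\<close>

lemma facet_of_simplex_iff:
  assumes i: "i \<in> J"
  shows "F facet_of convex hull (p ` (J - {i})) \<longleftrightarrow>
    (\<exists>u\<in>J - {i}. F = convex hull (p ` (J - {i} - {u})))"
proof -
  have diff: "p ` (J - {i}) - {p u} = p ` (J - {i} - {u})" if "u \<in> J - {i}" for u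
    using inj_on_remove[OF i] that by (auto dest: inj_onD)
  have "card (p ` (J - {i})) = DIM('a) + 1"
    using card_image[OF inj_on_remove[OF i]] card_J finite_J i by simp
  then have "2 \<le> card (p ` (J - {i}))"
    using DIM_positive[where 'a='a] by simp
  then show ?thesis
    by (subst facet_of_convex_hull_affine_independent_alt[OF affine_independent_remove[OF i]])
      (use diff in auto)
qed

text \<open>Equal facets would put \<open>p u\<close> into the hull of the other vertices, against
  affine independence. Facets can thus be counted by their opposite vertices.\<close>

lemma inj_on_facets:
  assumes i: "i \<in> J"
  shows "inj_on (\<lambda>u. convex hull (p ` (J - {i} - {u}))) (J - {i})"
proof (rule inj_onI, rule ccontr)
  fix u w assume uw: "u \<in> J - {i}" "w \<in> J - {i}" "u \<noteq> w"
    "convex hull (p ` (J - {i} - {u})) = convex hull (p ` (J - {i} - {w}))"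
  have *: "p ` (J - {i}) - {p u} = p ` (J - {i} - {u})"
    using inj_on_remove[OF i] uw(1) by (auto dest: inj_onD)
  have "p u \<in> p ` (J - {i} - {w})" using uw by blast
  then have "p u \<in> convex hull (p ` (J - {i} - {u}))"
    using uw(4) hull_inc by metis
  then have "p u \<in> affine hull (p ` (J - {i}) - {p u})"
    unfolding * using convex_hull_subset_affine_hull by blast
  then show False
    using affine_independent_remove[OF i] uw(1) unfolding affine_dependent_def by blast
qed

text \<open>The point \<open>p i\<close> is added to the simplex on the others. As \<open>c\<close>
  has no zero entry, each facet that \<open>p i\<close> is not beyond has it strictly
  beneath.\<close>

lemma T_polytope_convex_hull:
  assumes i: "i \<in> J" and k: "card {u \<in> J - {i}. 0 < c u * c i} = k" "1 \<le> k" "k \<le> DIM('a) - 1"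
  shows "T_polytope k (convex hull (p ` J))"
proof -
  let ?T = "convex hull (p ` (J - {i}))"
  have "card (p ` (J - {i})) = DIM('a) + 1"
    using card_image[OF inj_on_remove[OF i]] card_J finite_J i by simp
  then have "int DIM('a) simplex ?T"
    using affine_independent_remove[OF i] by (intro simplex_convex_hull) auto
  moreover have "inj_on (\<lambda>u. convex hull (p ` (J - {i} - {u}))) {u \<in> J - {i}. 0 < c u * c i}"
    by (rule inj_on_subset[OF inj_on_facets[OF i]]) blast
  from card_image[OF this] k(1)
  have "card ((\<lambda>u. convex hull (p ` (J - {i} - {u}))) ` {u \<in> J - {i}. 0 < c u * c i}) = k"
    by (rule trans)
  moreover have "{F. F facet_of ?T \<and> beyond (p i) ?T F} =
      (\<lambda>u. convex hull (p ` (J - {i} - {u}))) ` {u \<in> J - {i}. 0 < c u * c i}"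
    using beyond_facet_iff[OF i] by (auto simp: facet_of_simplex_iff[OF i])
  ultimately have simplex: "int DIM('a) simplex ?T"
    and card_beyond: "card {F. F facet_of ?T \<and> beyond (p i) ?T F} = k"
    by (simp_all only:)
  have beneath: "beneath (p i) ?T F" if F: "F facet_of ?T" "\<not> beyond (p i) ?T F" for F
  proof -
    obtain u where u: "u \<in> J - {i}" "F = convex hull (p ` (J - {i} - {u}))"
      using F(1) facet_of_simplex_iff[OF i] by blast
    have "\<not> 0 < c u * c i" using beyond_facet_iff[OF i u(1)] F(2) u(2) by simp
    moreover have "c u * c i \<noteq> 0" using c_nonzero i u(1) by simp
    ultimately have "c u * c i < 0" by linarith
    then show ?thesis using beneath_facet[OF i u(1)] u(2) by simp
  qed
  have "insert (p i) (p ` (J - {i})) = p ` J" using i by blast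
  then have "convex hull (p ` J) = convex hull (insert (p i) ?T)" by (metis hull_insert)
  then show ?thesis
    unfolding T_polytope_def using k(2,3) simplex card_beyond beneath by blast
qed

end

text \<open>
  The vectors of values \<open>b - a \<bullet> p j\<close> of affine functions are those orthogonal to the dependency,
  so rescaling them positively passes from one configuration to the other.
\<close>

lemma supporting_sets_mono:
  assumes "affine_circuit J p c" "affine_circuit J q c'"
    and sgn: "\<And>j. j \<in> J \<Longrightarrow> 0 < c j * c' j"
  shows "supporting_sets J p \<subseteq> supporting_sets J q"
proof
  interpret p: affine_circuit J p c by fact
  interpret q: affine_circuit J q c' by fact
  fix S assume "S \<in> supporting_sets J p"
  then obtain a b where S: "S \<subseteq> J" "\<And>j. j \<in> S \<Longrightarrow> a \<bullet> p j = b" "\<And>j. j \<in> J - S \<Longrightarrow> a \<bullet> p j < b"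
    unfolding supporting_sets_def by blast
  define z where "z j = c j / c' j * (a \<bullet> p j - b)" for j
  have "(\<Sum>j\<in>J. c' j * z j) = (\<Sum>j\<in>J. c j * (a \<bullet> p j - b))"
    using q.c_nonzero by (intro sum.cong) (auto simp: z_def)
  then have "(\<Sum>j\<in>J. c' j * z j) = 0" by (simp add: p.sum_dependency)
  then obtain a' b' where ab': "\<And>j. j \<in> J \<Longrightarrow> a' \<bullet> q j - b' = z j"
    using q.interpolation_orthogonal by metis
  have "a' \<bullet> q j = b'" if "j \<in> S" for j
    using ab'[of j] S that by (auto simp: z_def)
  moreover have "a' \<bullet> q j < b'" if "j \<in> J - S" for j
  proof -
    have "0 < c j / c' j" using sgn[of j] that by (simp add: zero_less_mult_iff zero_less_divide_iff)
    then have "z j < 0" using S(3)[OF that] unfolding z_def by (intro mult_pos_neg) auto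
    then show ?thesis using ab'[of j] that by simp
  qed
  ultimately show "S \<in> supporting_sets J q"
    unfolding supporting_sets_def using S(1) by (intro CollectI conjI exI[of _ a'] exI[of _ b'] ballI)
qed

lemma comb_equiv_affine_circuits:
  assumes "affine_circuit J p c" "affine_circuit J q c'" "\<And>j. j \<in> J \<Longrightarrow> 0 < c j * c' j"
  shows "comb_equiv (convex hull (p ` J)) (convex hull (q ` J))"
proof (rule comb_equiv_if_same_supporting_sets)
  show "finite J" using assms(1) by (rule affine_circuit.finite_J)
  show "supporting_sets J p = supporting_sets J q"
    using supporting_sets_mono[of J p c q c'] supporting_sets_mono[of J q c' p c] assms
    by (auto simp: mult.commute)
qed

section \<open>Coordinates\<close>

lemma bij_betw_coord_no:
  "bij_betw (coord_no :: 'n \<Rightarrow> nat) UNIV {1..CARD('n::{finite,linorder})}"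
proof -
  have "strict_mono (coord_no :: 'n \<Rightarrow> nat)"
  proof
    fix x y :: 'n assume "x < y"
    then have "{b. b \<le> x} \<subset> {b. b \<le> y}" by (auto dest: less_le_not_le[THEN iffD1])
    then show "coord_no x < coord_no y" unfolding coord_no_def by (intro psubset_card_mono) auto
  qed
  then have inj: "inj (coord_no :: 'n \<Rightarrow> nat)" by (rule strict_mono_imp_inj_on)
  have "coord_no x \<in> {1..CARD('n)}" for x :: 'n
  proof -
    have "0 < card {b. b \<le> x}" by (subst card_gt_0_iff) auto
    then show ?thesis unfolding coord_no_def by (auto simp: card_mono Suc_le_eq)
  qed
  then have "range (coord_no :: 'n \<Rightarrow> nat) \<subseteq> {1..CARD('n)}" by blast
  then have "range (coord_no :: 'n \<Rightarrow> nat) = {1..CARD('n)}"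
    by (intro card_subset_eq) (auto simp: card_image[OF inj])
  then show ?thesis using inj by (simp add: bij_betw_def)
qed

lemma coord_no_pos: "1 \<le> coord_no (a :: 'n)" and coord_no_le: "coord_no (a :: 'n) \<le> CARD('n::{finite,linorder})"
  using bij_betwE[OF bij_betw_coord_no[where 'n='n]] by auto

lemma coord_no_surj:
  assumes "1 \<le> m" "m \<le> CARD('n::{finite,linorder})"
  shows "\<exists>a :: 'n::{finite,linorder}. coord_no a = m"
proof -
  have "m \<in> range (coord_no :: 'n \<Rightarrow> nat)"
    using assms by (simp add: bij_betw_imp_surj_on[OF bij_betw_coord_no])
  then show ?thesis by blast
qed

section \<open>The moment curve\<close>

text \<open>Up to sign, an \<open>n\<close>-fold finite difference of a polynomial of degree below
  \<open>n\<close>. Pascal's rule peels off one difference, which lowers the degree.\<close>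

lemma alternating_binomial_sum:
  assumes "m < n"
  shows "(\<Sum>j\<le>n. (-1) ^ j * real (n choose j) * real (Suc j) ^ m) = 0"
  using assms
proof (induction n arbitrary: m)
  case (Suc n)
  define f where "f j = real (Suc j) ^ m" for j
  define e where "e j = (-1) ^ j * real (n choose j)" for j
  have "(\<Sum>j\<le>Suc n. (-1) ^ j * real (Suc n choose j) * f j)
      = f 0 + (\<Sum>j\<le>n. - ((-1) ^ j * (real (n choose j) + real (n choose Suc j)) * f (Suc j)))"
    by (subst sum.atMost_Suc_shift) simp
  also have "\<dots> = (f 0 + (\<Sum>j\<le>n. e (Suc j) * f (Suc j))) - (\<Sum>j\<le>n. e j * f (Suc j))"
    by (simp add: e_def algebra_simps sum_negf sum.distrib sum_subtractf)
  also have "f 0 + (\<Sum>j\<le>n. e (Suc j) * f (Suc j)) = (\<Sum>j\<le>Suc n. e j * f j)"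
    by (subst sum.atMost_Suc_shift) (simp add: e_def)
  also have "\<dots> = (\<Sum>j\<le>n. e j * f j)"
    by (simp add: e_def)
  finally have eq: "(\<Sum>j\<le>Suc n. (-1) ^ j * real (Suc n choose j) * f j)
      = - (\<Sum>j\<le>n. e j * (f (Suc j) - f j))"
    by (simp add: algebra_simps sum_subtractf)
  \<comment> \<open>The top term of the binomial expansion cancels; the remaining exponents are
    below \<open>m\<close>, hence below \<open>n\<close> as the induction hypothesis
    demands.\<close>
  have "f (Suc j) - f j = (\<Sum>l<m. real (m choose l) * real (Suc j) ^ l)" for j
  proof -
    have "f (Suc j) = (real (Suc j) + 1) ^ m" by (simp add: f_def algebra_simps)
    also have "\<dots> = (\<Sum>l\<le>m. real (m choose l) * real (Suc j) ^ l)"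
      by (subst binomial_ring) simp
    finally show ?thesis by (simp add: f_def lessThan_Suc_atMost[symmetric])
  qed
  then have "(\<Sum>j\<le>n. e j * (f (Suc j) - f j))
      = (\<Sum>j\<le>n. \<Sum>l<m. real (m choose l) * (e j * real (Suc j) ^ l))"
    by (simp add: sum_distrib_left mult_ac)
  also have "\<dots> = (\<Sum>l<m. real (m choose l) * (\<Sum>j\<le>n. e j * real (Suc j) ^ l))"
    by (subst sum.swap) (simp add: sum_distrib_left)
  also have "\<dots> = 0"
    using Suc by (simp add: e_def)
  finally show ?case using eq by (simp add: f_def)
qed simp

text \<open>A Vandermonde argument: \<open>w\<close> annihilates every polynomial of degree below
  \<open>card K\<close>, in particular the one whose roots are all nodes but
  \<open>t i\<close>.\<close>

lemma vanishing_moments_eq_zero: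
  fixes t w :: "'i \<Rightarrow> real"
  assumes "finite K" "inj_on t K" "\<And>m. m < card K \<Longrightarrow> (\<Sum>j\<in>K. w j * t j ^ m) = 0" "i \<in> K"
  shows "w i = 0"
proof -
  define P where "P = (\<Prod>k\<in>K - {i}. [:- t k, 1:])"
  have "degree P = (\<Sum>k\<in>K - {i}. degree [:- t k, 1:])"
    unfolding P_def by (rule degree_prod_sum_eq) simp
  also have "\<dots> = card (K - {i})" by simp
  also have "\<dots> < card K" using assms by (intro card_Diff1_less)
  finally have deg: "degree P < card K" .
  have "(\<Sum>j\<in>K. w j * poly P (t j)) = (\<Sum>m\<le>degree P. coeff P m * (\<Sum>j\<in>K. w j * t j ^ m))"
    by (simp add: poly_altdef sum_distrib_left mult_ac) (rule sum.swap)
  also have "\<dots> = 0"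
    using assms(3) deg by simp
  finally have "0 = (\<Sum>j\<in>K. w j * poly P (t j))" by simp
  also have "\<dots> = w i * poly P (t i) + (\<Sum>j\<in>K - {i}. w j * poly P (t j))"
    using assms by (simp add: sum.remove)
  also have "(\<Sum>j\<in>K - {i}. w j * poly P (t j)) = 0"
    using \<open>finite K\<close> by (intro sum.neutral) (auto simp: P_def poly_prod)
  finally have "w i * poly P (t i) = 0" by simp
  moreover have "poly P (t i) \<noteq> 0"
    using assms by (auto simp: P_def poly_prod dest: inj_onD)
  ultimately show ?thesis by simp
qed

text \<open>The sum condition and the coordinates are the moments 0 to \<open>d\<close> of
  \<open>u\<close>. Subtracting a multiple of the binomial dependency leaves \<open>d + 1\<close>
  nodes, on which these moments force 0.\<close>

lemma affine_circuit_moment_curve: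
  fixes d :: nat
  defines "d \<equiv> CARD('n::{finite,linorder})"
  shows "affine_circuit {..d + 1} (\<lambda>j. moment_curve (real (Suc j)) :: real ^ 'n::{finite,linorder})
    (\<lambda>j. (-1) ^ j * real (d + 1 choose j))"
proof
  let ?J = "{..d + 1}" and ?c = "\<lambda>j. (-1) ^ j * real (d + 1 choose j)"
    and ?q = "\<lambda>j. moment_curve (real (Suc j)) :: real ^ 'n::{finite,linorder}"
  show "finite ?J" by simp
  show "card ?J = DIM(real ^ 'n::{finite,linorder}) + 2" by (simp add: d_def)
  show "sum ?c ?J = 0"
    using alternating_binomial_sum[of 0 "d + 1"] by simp
  show "(\<Sum>j\<in>?J. ?c j *\<^sub>R ?q j) = 0"
  proof (subst vec_eq_iff, rule allI)
    fix a :: 'n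
    have "coord_no a < d + 1" using coord_no_le[of a] by (simp add: d_def)
    from alternating_binomial_sum[OF this]
    show "(\<Sum>j\<in>?J. ?c j *\<^sub>R ?q j) $ a = 0 $ a" by (simp add: moment_curve_def)
  qed
  show "?c j \<noteq> 0" if "j \<in> ?J" for j using that by simp
  fix u :: "nat \<Rightarrow> real" assume u0: "sum u ?J = 0" and u1: "(\<Sum>j\<in>?J. u j *\<^sub>R ?q j) = 0"
  have mom: "(\<Sum>j\<le>d + 1. u j * real (Suc j) ^ m) = 0" if "m < d + 1" for m
  proof (cases "m = 0")
    case True then show ?thesis using u0 by simp
  next
    case False
    then have "\<exists>a :: 'n. coord_no a = m"
      using that by (intro coord_no_surj) (auto simp: d_def)
    then obtain a :: 'n where a: "coord_no a = m" by blast
    have "(\<Sum>j\<in>?J. u j *\<^sub>R ?q j) $ a = 0" using u1 by simp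
    then show ?thesis using a by (simp add: moment_curve_def)
  qed
  \<comment> \<open>\<open>?c 0\<close> is 1, so \<open>w\<close> vanishes at index 0 and the first
    node drops out.\<close>
  define w where "w j = u j - u 0 * ?c j" for j
  have moments: "(\<Sum>j\<in>{1..d + 1}. w j * real (Suc j) ^ m) = 0" if "m < d + 1" for m
  proof -
    have "(\<Sum>j\<le>d + 1. w j * real (Suc j) ^ m)
        = (\<Sum>j\<le>d + 1. u j * real (Suc j) ^ m) - u 0 * (\<Sum>j\<le>d + 1. ?c j * real (Suc j) ^ m)"
      by (simp only: w_def left_diff_distrib sum_subtractf sum_distrib_left mult.assoc)
    also have "\<dots> = 0"
      by (simp only: mom[OF that] alternating_binomial_sum[OF that])
    finally have "(\<Sum>j\<le>d + 1. w j * real (Suc j) ^ m) = 0" .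
    moreover have "(\<Sum>j\<in>{1..d + 1}. w j * real (Suc j) ^ m) = (\<Sum>j\<le>d + 1. w j * real (Suc j) ^ m)"
      by (rule sum.mono_neutral_left) (auto simp: w_def not_less_eq_eq)
    ultimately show ?thesis by (simp only:)
  qed
  have "w j = 0" if "j \<in> {1..d + 1}" for j
  proof (rule vanishing_moments_eq_zero[of "{1..d + 1}" "\<lambda>j. real (Suc j)"])
    show "(\<Sum>j\<in>{1..d + 1}. w j * real (Suc j) ^ m) = 0" if "m < card {1..d + 1}" for m
      by (rule moments) (use that in simp)
  qed (use that in \<open>simp_all add: inj_on_def\<close>)
  moreover have "w 0 = 0" by (simp add: w_def)
  ultimately have "w j = 0" if "j \<in> ?J" for j
    using that by (cases "j = 0") auto
  then have "u j = u 0 * ?c j" if "j \<in> ?J" for j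
    using that unfolding w_def right_minus_eq .
  then show "\<exists>k. \<forall>j\<in>?J. u j = k * ?c j" by blast
qed

section \<open>The Laplacian of the boundary of a simplex\<close>

text \<open>Only faces of the form \<open>\<sigma> - {j}\<close> contribute to the sum over \<tau>,
  and by assumption all of them occur there.\<close>

lemma laplacian_eq_sum:
  assumes "\<And>j. j \<in> \<sigma> \<Longrightarrow> \<sigma> - {j} \<in> k_faces \<Delta> (k - 1)" "finite (k_faces \<Delta> (k - 1))"
    "finite \<sigma>" "finite \<sigma>'"
  shows "laplacian \<Delta> k \<sigma> \<sigma>' = (\<Sum>j\<in>\<sigma>. \<Sum>j'\<in>\<sigma>'. if \<sigma> - {j} = \<sigma>' - {j'}
    then (-1) ^ card {i \<in> \<sigma>. i < j} * (-1) ^ card {i \<in> \<sigma>'. i < j'} else 0)"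
proof -
  have "laplacian \<Delta> k \<sigma> \<sigma>' = (\<Sum>j\<in>\<sigma>. \<Sum>\<tau>\<in>k_faces \<Delta> (k - 1).
      if \<tau> = \<sigma> - {j} then (-1) ^ card {i \<in> \<sigma>. i < j} * boundary_coeff \<tau> \<sigma>' else 0)"
    unfolding laplacian_def boundary_coeff_def[of _ \<sigma>] sum_distrib_right
    by (subst sum.swap) (intro sum.cong refl, simp)
  also have "\<dots> = (\<Sum>j\<in>\<sigma>. (-1) ^ card {i \<in> \<sigma>. i < j} * boundary_coeff (\<sigma> - {j}) \<sigma>')"
    using assms by (intro sum.cong) auto
  also have "\<dots> = (\<Sum>j\<in>\<sigma>. \<Sum>j'\<in>\<sigma>'. if \<sigma> - {j} = \<sigma>' - {j'}
    then (-1) ^ card {i \<in> \<sigma>. i < j} * (-1) ^ card {i \<in> \<sigma>'. i < j'} else 0)"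
    unfolding boundary_coeff_def sum_distrib_left by (intro sum.cong refl) simp
  finally show ?thesis .
qed

text \<open>A facet has \<open>d + 1\<close> ridges, each contributing a squared sign. Facets
  omitting distinct \<open>a\<close> and \<open>b\<close> meet in the single ridge omitting both, so
  one product of signs remains.\<close>

lemma laplacian_boundary_simplex:
  assumes d: "1 \<le> d" and a: "a \<in> {1..d + 2}" and b: "b \<in> {1..d + 2}"
  shows "laplacian (boundary_complex d) d ({1..d + 2} - {a}) ({1..d + 2} - {b})
    = (if a = b then int d + 1 else - ((-1) ^ (a + b)))"
proof -
  let ?V = "{1..d + 2}"
  let ?\<sigma> = "?V - {a}" and ?\<sigma>' = "?V - {b}"
  have fin: "finite (k_faces (boundary_complex d) (d - 1))"
    by (simp add: k_faces_def boundary_complex_def full_simplex_def)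
  have ridge: "?\<sigma> - {j} \<in> k_faces (boundary_complex d) (d - 1)" if "j \<in> ?\<sigma>" for j
  proof -
    have "card (?\<sigma> - {j}) = d" using that a by simp
    moreover have "?\<sigma> - {j} \<noteq> ?V" using a by blast
    ultimately show ?thesis
      using d by (auto simp: k_faces_def boundary_complex_def full_simplex_def)
  qed
  have eq: "laplacian (boundary_complex d) d ?\<sigma> ?\<sigma>' = (\<Sum>j\<in>?\<sigma>. \<Sum>j'\<in>?\<sigma>'. if ?\<sigma> - {j} = ?\<sigma>' - {j'}
    then (-1) ^ card {i \<in> ?\<sigma>. i < j} * (-1) ^ card {i \<in> ?\<sigma>'. i < j'} else 0)"
    by (rule laplacian_eq_sum[OF ridge fin]) auto
  show ?thesis
  proof (cases "a = b")
    case True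
    have "(?\<sigma> - {j} = ?\<sigma>' - {j'}) = (j' = j)" if "j \<in> ?\<sigma>" "j' \<in> ?\<sigma>'" for j j'
      using that True by blast
    then have "laplacian (boundary_complex d) d ?\<sigma> ?\<sigma>' = (\<Sum>j\<in>?\<sigma>. \<Sum>j'\<in>?\<sigma>'. if j' = j
      then (-1) ^ card {i \<in> ?\<sigma>. i < j} * (-1) ^ card {i \<in> ?\<sigma>'. i < j'} else 0)"
      unfolding eq by (intro sum.cong refl) simp
    also have "\<dots> = (\<Sum>j\<in>?\<sigma>. 1)"
      using True by (intro sum.cong refl) (simp flip: power_add power_mult_distrib)
    also have "\<dots> = int d + 1" using a by simp
    finally show ?thesis using True by simp
  next
    case False
    have "(?\<sigma> - {j} = ?\<sigma>' - {j'}) = (j = b \<and> j' = a)" if "j \<in> ?\<sigma>" "j' \<in> ?\<sigma>'" for j j'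
    proof
      assume *: "?\<sigma> - {j} = ?\<sigma>' - {j'}"
      have "b \<notin> ?\<sigma> - {j}" "a \<notin> ?\<sigma>' - {j'}" using * by blast+
      then show "j = b \<and> j' = a" using a b False by simp
    qed auto
    then have "laplacian (boundary_complex d) d ?\<sigma> ?\<sigma>' = (\<Sum>j\<in>?\<sigma>. \<Sum>j'\<in>?\<sigma>'. if j' = a then
      (if j = b then (-1) ^ card {i \<in> ?\<sigma>. i < j} * (-1) ^ card {i \<in> ?\<sigma>'. i < j'} else 0) else 0)"
      unfolding eq by (intro sum.cong refl) simp
    also have "\<dots> = (-1) ^ card {i \<in> ?\<sigma>. i < b} * (-1) ^ card {i \<in> ?\<sigma>'. i < a}"
      using False a b by (simp add: sum.delta)
    finally have L: "laplacian (boundary_complex d) d ?\<sigma> ?\<sigma>' =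
      (-1) ^ (card {i \<in> ?\<sigma>. i < b} + card {i \<in> ?\<sigma>'. i < a})" by (simp add: power_add)
    have below: "card {i \<in> ?V - {x}. i < y} = y - 1 - (if x < y then 1 else 0)"
      if "x \<in> ?V" "y \<in> ?V" for x y
    proof -
      have "{i \<in> ?V - {x}. i < y} = {1..<y} - {x}" using that by auto
      then show ?thesis using that by (auto simp: card_Diff_singleton_if)
    qed
    \<comment> \<open>Exactly one of \<open>a < b\<close> and \<open>b < a\<close> holds, so the
      counts add up to \<open>(a - 1) + (b - 1) - 1\<close>; the odd shift 3 yields the minus
      sign.\<close>
    have "a + b = Suc (Suc (Suc (card {i \<in> ?\<sigma>. i < b} + card {i \<in> ?\<sigma>'. i < a})))"
      unfolding below[OF a b] below[OF b a] using False a b by auto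
    then have "(-1 :: int) ^ (a + b) = - ((-1) ^ (card {i \<in> ?\<sigma>. i < b} + card {i \<in> ?\<sigma>'. i < a}))"
      by (simp only: power_Suc mult_minus1 minus_minus)
    then show ?thesis using L False by simp
  qed
qed

text \<open>Reversing the numbering preserves the parity of the sign exponent. Writing the diagonal
  entry \<open>d + 1\<close> as \<open>(d + 2) - 1\<close> exhibits a multiple of the identity minus
  a rank-one matrix.\<close>

lemma laplacian_matrix_entry:
  assumes "1 \<le> d" and i: "i \<in> {1..d + 2}" and j: "j \<in> {1..d + 2}"
  shows "laplacian_matrix d i j = (if i = j then int d + 2 else 0) - (-1) ^ i * (-1) ^ j"
proof -
  have *: "d + 3 - i \<in> {1..d + 2}" "d + 3 - j \<in> {1..d + 2}" using i j by auto
  have "(d + 3 - i) + (d + 3 - j) + (i + j) = 2 * (d + 3)" using i j by auto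
  then have "even ((d + 3 - i) + (d + 3 - j)) = even (i + j)" by (metis dvd_triv_left even_add)
  then have "(-1 :: int) ^ ((d + 3 - i) + (d + 3 - j)) = (-1) ^ (i + j)"
    by (simp add: uminus_power_if)
  moreover have "d + 3 - i = d + 3 - j \<longleftrightarrow> i = j" using i j by auto
  ultimately show ?thesis
    unfolding laplacian_matrix_def facet_no_def laplacian_boundary_simplex[OF assms(1) *]
    by (auto simp: power_add simp flip: power_mult_distrib)
qed

section \<open>The reduced columns as a circuit with alternating dependency\<close>

lemma reduced_column_Suc:
  fixes a :: "'n::{finite,linorder}"
  assumes "j \<le> CARD('n::{finite,linorder}) + 1"
  shows "(reduced_column (Suc j) :: real ^ 'n::{finite,linorder}) $ a =
    (if j = coord_no a + 1 then real CARD('n::{finite,linorder}) + 2 else 0) + (-1) ^ coord_no a * (-1) ^ j"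
  \<comment> \<open>Coordinate \<open>a\<close> comes from row \<open>coord_no a + 2\<close>, whose
    diagonal entry is in column \<open>Suc j\<close> with \<open>j = coord_no a + 1\<close>.
    Counting columns from 0 flips the sign of the rank-one part.\<close>
  using assms coord_no_pos[of a] coord_no_le[of a]
  by (simp add: reduced_column_def laplacian_matrix_entry)

lemma sum_alternating: "(\<Sum>j<2 * n. (-1 :: real) ^ j) = 0"
  by (induction n) auto

text \<open>Evenness of \<open>d\<close> makes the alternating signs sum to 0. For uniqueness, the
  rows express the entries of \<open>u\<close> with index at least 2 through its alternating sum;
  two linear equations settle the other two.\<close>

lemma affine_circuit_reduced_column:
  fixes d :: nat
  defines "d \<equiv> CARD('n::{finite,linorder})"
  assumes "even d"
  shows "affine_circuit {..d + 1} (\<lambda>j. reduced_column (Suc j) :: real ^ 'n::{finite,linorder})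
    (\<lambda>j. (-1) ^ j)"
proof
  let ?J = "{..d + 1}" and ?p = "\<lambda>j. reduced_column (Suc j) :: real ^ 'n::{finite,linorder}"
  have "even (d + 2)" using \<open>even d\<close> by simp
  then obtain n where n: "d + 2 = 2 * n" by (rule evenE)
  have row: "(\<Sum>j\<in>?J. u j *\<^sub>R ?p j) $ a = (real d + 2) * u (coord_no a + 1)
      + (-1) ^ coord_no a * (\<Sum>j\<in>?J. (-1) ^ j * u j)" for u and a :: 'n
  proof -
    have "(\<Sum>j\<in>?J. u j *\<^sub>R ?p j) $ a = (\<Sum>j\<in>?J. (if j = coord_no a + 1 then (real d + 2) * u j else 0)
        + (-1) ^ coord_no a * ((-1) ^ j * u j))"
      unfolding sum_component
      by (intro sum.cong refl) (auto simp: reduced_column_Suc d_def algebra_simps)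
    also have "\<dots> = (\<Sum>j\<in>?J. if j = coord_no a + 1 then (real d + 2) * u j else 0)
        + (-1) ^ coord_no a * (\<Sum>j\<in>?J. (-1) ^ j * u j)"
      by (simp only: sum.distrib sum_distrib_left)
    also have "(\<Sum>j\<in>?J. if j = coord_no a + 1 then (real d + 2) * u j else 0)
        = (real d + 2) * u (coord_no a + 1)"
      using coord_no_le[of a] by (simp add: d_def)
    finally show ?thesis .
  qed
  have square: "(-1 :: real) ^ j * (-1) ^ j = 1" for j
    by (simp flip: power_mult_distrib)
  show "finite ?J" by simp
  show "card ?J = DIM(real ^ 'n::{finite,linorder}) + 2" by (simp add: d_def)
  have "?J = {..<2 * n}" using n by auto
  then show c0: "(\<Sum>j\<in>?J. (-1 :: real) ^ j) = 0" by (simp only: sum_alternating)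
  show "(\<Sum>j\<in>?J. (-1) ^ j *\<^sub>R ?p j) = 0"
    by (simp only: vec_eq_iff row square) (simp add: algebra_simps)
  show "(-1 :: real) ^ j \<noteq> 0" if "j \<in> ?J" for j by simp
  fix u :: "nat \<Rightarrow> real" assume u0: "sum u ?J = 0" and u1: "(\<Sum>j\<in>?J. u j *\<^sub>R ?p j) = 0"
  define s where "s = (\<Sum>j\<in>?J. (-1) ^ j * u j)"
  \<comment> \<open>Row \<open>a\<close> makes \<open>u j\<close> equal to
    \<open>k * (-1) ^ j\<close> at \<open>j = coord_no a + 1\<close>.\<close>
  define k where "k = s / (real d + 2)"
  define w where "w j = u j - k * (-1) ^ j" for j
  have w2: "w j = 0" if j: "j \<in> {2..d + 1}" for j
  proof -
    have "\<exists>a :: 'n. coord_no a = j - 1"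
      using j by (intro coord_no_surj) (auto simp: d_def)
    then obtain a :: 'n where a: "coord_no a = j - 1" by blast
    obtain m where m: "j = Suc m" using j by (cases j) auto
    have "(real d + 2) * u (coord_no a + 1) + (-1) ^ coord_no a * s = 0"
      using row[of u a] by (simp only: u1 s_def zero_index)
    then have "(real d + 2) * u j + (-1) ^ m * s = 0"
      by (simp add: a m)
    then show ?thesis by (simp add: w_def k_def m field_simps)
  qed
  have sum_J: "sum f ?J = f 0 + f 1" if "\<And>j. j \<in> {2..d + 1} \<Longrightarrow> f j = 0" for f :: "nat \<Rightarrow> real"
  proof -
    have "sum f ?J = sum f {0, 1}"
      by (rule sum.mono_neutral_right) (use that in auto)
    then show ?thesis by simp
  qed
  have "sum w ?J = sum u ?J - k * (\<Sum>j\<in>?J. (-1) ^ j)"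
    unfolding w_def[abs_def] sum_subtractf sum_distrib_left by (rule refl)
  then have "sum w ?J = 0" by (simp only: u0 c0)
  then have sum1: "w 0 + w 1 = 0" using sum_J[of w, OF w2] by (simp only:)
  \<comment> \<open>The alternating sum of \<open>w\<close> vanishes like the plain one, since
    \<open>s\<close> is \<open>(d + 2) * k\<close>; so \<open>w 0\<close> and \<open>w 1\<close>
    have sum and difference 0.\<close>
  have "w 0 - w 1 = (\<Sum>j\<in>?J. (-1) ^ j * w j)"
    by (subst sum_J) (use w2 in simp_all)
  also have "\<dots> = (\<Sum>j\<in>?J. (-1) ^ j * u j - k * ((-1) ^ j * (-1) ^ j))"
    by (intro sum.cong refl) (simp only: w_def right_diff_distrib mult.left_commute)
  also have "\<dots> = s - (\<Sum>j\<in>?J. k)"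
    by (simp only: square mult_1_right sum_subtractf s_def)
  also have "\<dots> = 0" by (simp only: k_def) (simp add: field_simps)
  finally have "w 0 - w 1 = 0" .
  with sum1 have "w 0 = 0" "w 1 = 0" by auto
  then have "w j = 0" if "j \<in> ?J" for j
    using w2[of j] that by (cases "j = 0"; cases "j = 1") auto
  then show "\<exists>k. \<forall>j\<in>?J. u j = k * (-1) ^ j"
    by (intro exI[of _ k]) (simp add: w_def)
qed

theorem theorem5p4:
  fixes d :: nat
  assumes "d = CARD('n::{finite,linorder})"
    and "d \<ge> 2"
    and "even d"
  shows "of_type_T (d div 2) (laplacian_polytope :: (real ^ 'n::{finite,linorder}) set) \<and>
         (\<exists>C :: (real ^ 'n::{finite,linorder}) set. cyclic_polytope (d + 2) C \<and>
            comb_equiv (laplacian_polytope :: (real ^ 'n::{finite,linorder}) set) C)"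
proof
  let ?J = "{..d + 1}"
  let ?p = "\<lambda>j. reduced_column (Suc j) :: real ^ 'n::{finite,linorder}"
  let ?q = "\<lambda>j. moment_curve (real (Suc j)) :: real ^ 'n::{finite,linorder}"
  have p: "affine_circuit ?J ?p (\<lambda>j. (-1) ^ j)"
    using affine_circuit_reduced_column[where 'n='n] assms by simp
  have q: "affine_circuit ?J ?q (\<lambda>j. (-1) ^ j * real (d + 1 choose j))"
    using affine_circuit_moment_curve[where 'n='n] assms by simp
  have "{1..CARD('n) + 2} = Suc ` ?J"
    by (simp add: image_Suc_atMost assms(1))
  then have P: "laplacian_polytope = convex hull (?p ` ?J)"
    unfolding laplacian_polytope_def by (simp add: image_image)
  \<comment> \<open>Index 0 serves as the added vertex; the other indices of positive sign are 2, 4,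
    ..., \<open>d\<close>.\<close>
  have "{u \<in> ?J - {0}. 0 < (-1 :: real) ^ u * (-1) ^ 0} = (\<lambda>j. 2 * j) ` {1..d div 2}"
    using \<open>even d\<close> by (auto simp: uminus_power_if image_iff elim!: evenE)
  then have "card {u \<in> ?J - {0}. 0 < (-1 :: real) ^ u * (-1) ^ 0} = d div 2"
    by (simp add: card_image inj_on_def)
  then have "T_polytope (d div 2) (laplacian_polytope :: (real ^ 'n::{finite,linorder}) set)"
    unfolding P using assms by (intro affine_circuit.T_polytope_convex_hull[OF p, of 0]) auto
  then show "of_type_T (d div 2) (laplacian_polytope :: (real ^ 'n::{finite,linorder}) set)"
    unfolding of_type_T_def using comb_equiv_refl by blast
  have "cyclic_polytope (d + 2) (convex hull (?q ` ?J))"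
    unfolding cyclic_polytope_def
    by (rule exI[of _ "(\<lambda>j. real (Suc j)) ` ?J"]) (auto simp: card_image inj_on_def image_image)
  \<comment> \<open>The product of the two coefficients at \<open>j\<close> is
    \<open>d + 1 choose j\<close>, positive on \<open>?J\<close>.\<close>
  moreover have "comb_equiv (laplacian_polytope :: (real ^ 'n::{finite,linorder}) set) (convex hull (?q ` ?J))"
    unfolding P by (rule comb_equiv_affine_circuits[OF p q]) (simp flip: mult.assoc power_mult_distrib)
  ultimately show "\<exists>C :: (real ^ 'n::{finite,linorder}) set. cyclic_polytope (d + 2) C \<and>
      comb_equiv (laplacian_polytope :: (real ^ 'n::{finite,linorder}) set) C" by blast
qed

end
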